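(* Let $(X,\mu,\mathcal{E},\mathcal{F})$ be a symmetric Dirichlet space whose semigroup $\{P_t\}$ is conservative and admits a measurable heat kernel $p_t(x,y)$ satisfying, for some $C>0$ and $\beta>0$, \[ p_t(x,y)\le C\,t^{-\beta} \] for $\mu\times\mu$-a.e. $(x,y)\in X\times X$ and each $t\in(0,+\infty)$. Let $0<\alpha<\beta$. There exists a constant $C_{\mathrm{iso}}>0$ such that for every measurable set $E\subset X$ with $\mathbf{1}_E\in\mathbf{B}^{1,\alpha}(X)$, \[ \mu(E)^{\frac{\beta-\alpha}{\beta}}\le C_{\mathrm{iso}}\,\|\mathbf{1}_E\|_{1,\alpha}. \]
   Context: $X$ is a topological space equipped with a Radon measure $\mu$; $\mathcal{E}$ is a symmetric Dirichlet form on $L^2(X,\mu)$ with domain $\mathcal{F}$; $\{P_t\}_{t\ge0}$ is the associated Markovian semigroup; conservative means $P_t1=1$. A heat kernel is a (symmetric, nonnegative, measurable) function $p_t(x,y)$ with $P_tf(x)=\int_Xp_t(x,y)f(y)\,d\mu(y)$. For $p\ge1$, $\alpha\ge0$, $f\in L^p(X,\mu)$, \[ \|f\|_{p,\alpha}=\sup_{t>0}t^{-\alpha}\left(\int_X\int_X|f(x)-f(y)|^pp_t(x,y)\,d\mu(x)\,d\mu(y)\right)^{1/p}, \] and $\mathbf{B}^{p,\alpha}(X)=\{f\in L^p(X,\mu):\|f\|_{p,\alpha}<\infty\}$. *)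

theory Defs
  imports "HOL-Analysis.Analysis"
begin

text \<open>
  Functions on the space are real-valued representatives; elements of \<open>L\<^sup>p\<close> are classes of
  representatives modulo a.e. equality, so every structure below is required to be compatible
  with a.e. equality.
\<close>

text \<open>
  A Borel measure that is locally finite and inner regular with respect to compact sets. Neither the
  Hausdorff property nor \<open>\<sigma>\<close>-finiteness is part of the definition; the condition
  \<open>K \<in> sets M\<close> is automatic on a Hausdorff space.
\<close>

definition radon_measure :: "'a::topological_space measure \<Rightarrow> bool" where
  "radon_measure M \<longleftrightarrow>
     sets M = sets borel \<and>
     (\<forall>x. \<exists>U. open U \<and> x \<in> U \<and> emeasure M U < \<infinity>) \<and>
     (\<forall>A\<in>sets M. emeasure M A = (SUP K\<in>{K. compact K \<and> K \<in> sets M \<and> K \<subseteq> A}. emeasure M K))"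

definition Lp_space :: "'a measure \<Rightarrow> real \<Rightarrow> ('a \<Rightarrow> real) set" where
  "Lp_space M p = {f \<in> borel_measurable M. integrable M (\<lambda>x. \<bar>f x\<bar> powr p)}"

abbreviation L2_space :: "'a measure \<Rightarrow> ('a \<Rightarrow> real) set" where
  "L2_space M \<equiv> Lp_space M 2"

definition L2_inner :: "'a measure \<Rightarrow> ('a \<Rightarrow> real) \<Rightarrow> ('a \<Rightarrow> real) \<Rightarrow> real" where
  "L2_inner M f g = (\<integral>x. f x * g x \<partial>M)"

definition L2_norm :: "'a measure \<Rightarrow> ('a \<Rightarrow> real) \<Rightarrow> real" where
  "L2_norm M f = sqrt (L2_inner M f f)"

definition AE_eq :: "'a measure \<Rightarrow> ('a \<Rightarrow> real) \<Rightarrow> ('a \<Rightarrow> real) \<Rightarrow> bool" where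
  "AE_eq M f g \<longleftrightarrow> (AE x in M. f x = g x)"

locale dirichlet_form =
  fixes M :: "'a measure"
    and \<E> :: "('a \<Rightarrow> real) \<Rightarrow> ('a \<Rightarrow> real) \<Rightarrow> real"
    and \<F> :: "('a \<Rightarrow> real) set"
  assumes dom_subset: "\<F> \<subseteq> L2_space M"
    and dom_AE: "\<lbrakk>f \<in> \<F>; g \<in> L2_space M; AE_eq M f g\<rbrakk> \<Longrightarrow> g \<in> \<F>"
    and form_AE: "\<lbrakk>f \<in> \<F>; g \<in> \<F>; h \<in> \<F>; AE_eq M f g\<rbrakk> \<Longrightarrow> \<E> f h = \<E> g h"
    and dom_zero: "(\<lambda>x. 0) \<in> \<F>"
    and dom_add: "\<lbrakk>f \<in> \<F>; g \<in> \<F>\<rbrakk> \<Longrightarrow> (\<lambda>x. f x + g x) \<in> \<F>"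
    and dom_scale: "f \<in> \<F> \<Longrightarrow> (\<lambda>x. c * f x) \<in> \<F>"
    and form_sym: "\<lbrakk>f \<in> \<F>; g \<in> \<F>\<rbrakk> \<Longrightarrow> \<E> f g = \<E> g f"
    and form_add: "\<lbrakk>f \<in> \<F>; g \<in> \<F>; h \<in> \<F>\<rbrakk> \<Longrightarrow> \<E> (\<lambda>x. f x + g x) h = \<E> f h + \<E> g h"
    and form_scale: "\<lbrakk>f \<in> \<F>; h \<in> \<F>\<rbrakk> \<Longrightarrow> \<E> (\<lambda>x. c * f x) h = c * \<E> f h"
    and form_nonneg: "f \<in> \<F> \<Longrightarrow> 0 \<le> \<E> f f"
    and densely_defined: "\<lbrakk>f \<in> L2_space M; 0 < e\<rbrakk> \<Longrightarrow> \<exists>g\<in>\<F>. L2_norm M (\<lambda>x. f x - g x) < e"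
    and closed_form:
      "\<lbrakk>\<And>n. u n \<in> \<F>;
        \<And>e. 0 < e \<Longrightarrow> \<exists>N. \<forall>m\<ge>N. \<forall>n\<ge>N.
           \<E> (\<lambda>x. u m x - u n x) (\<lambda>x. u m x - u n x) + (L2_norm M (\<lambda>x. u m x - u n x))\<^sup>2 < e\<rbrakk>
       \<Longrightarrow> \<exists>f\<in>\<F>. (\<lambda>n. \<E> (\<lambda>x. u n x - f x) (\<lambda>x. u n x - f x)
                       + (L2_norm M (\<lambda>x. u n x - f x))\<^sup>2) \<longlonglongrightarrow> 0"
    and markovian_dom: "f \<in> \<F> \<Longrightarrow> (\<lambda>x. min (max (f x) 0) 1) \<in> \<F>"
    and markovian_form:
      "f \<in> \<F> \<Longrightarrow> \<E> (\<lambda>x. min (max (f x) 0) 1) (\<lambda>x. min (max (f x) 0) 1) \<le> \<E> f f"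

locale markovian_semigroup =
  fixes M :: "'a measure" and P :: "real \<Rightarrow> ('a \<Rightarrow> real) \<Rightarrow> 'a \<Rightarrow> real"
  assumes sg_L2: "\<lbrakk>0 \<le> t; f \<in> L2_space M\<rbrakk> \<Longrightarrow> P t f \<in> L2_space M"
    and sg_AE: "\<lbrakk>0 \<le> t; f \<in> L2_space M; g \<in> L2_space M; AE_eq M f g\<rbrakk> \<Longrightarrow> AE_eq M (P t f) (P t g)"
    and sg_add: "\<lbrakk>0 \<le> t; f \<in> L2_space M; g \<in> L2_space M\<rbrakk>
       \<Longrightarrow> AE_eq M (P t (\<lambda>x. f x + g x)) (\<lambda>x. P t f x + P t g x)"
    and sg_scale: "\<lbrakk>0 \<le> t; f \<in> L2_space M\<rbrakk> \<Longrightarrow> AE_eq M (P t (\<lambda>x. c * f x)) (\<lambda>x. c * P t f x)"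
    and sg_zero: "f \<in> L2_space M \<Longrightarrow> AE_eq M (P 0 f) f"
    and sg_semigroup: "\<lbrakk>0 \<le> s; 0 \<le> t; f \<in> L2_space M\<rbrakk> \<Longrightarrow> AE_eq M (P (s + t) f) (P s (P t f))"
    and sg_contraction: "\<lbrakk>0 \<le> t; f \<in> L2_space M\<rbrakk> \<Longrightarrow> L2_norm M (P t f) \<le> L2_norm M f"
    and sg_symmetric: "\<lbrakk>0 \<le> t; f \<in> L2_space M; g \<in> L2_space M\<rbrakk>
       \<Longrightarrow> L2_inner M (P t f) g = L2_inner M f (P t g)"
    and sg_continuous: "f \<in> L2_space M
       \<Longrightarrow> ((\<lambda>t. L2_norm M (\<lambda>x. P t f x - f x)) \<longlongrightarrow> 0) (at_right 0)"
    and sg_markovian: "\<lbrakk>0 \<le> t; f \<in> L2_space M; AE x in M. 0 \<le> f x \<and> f x \<le> 1\<rbrakk>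
       \<Longrightarrow> AE x in M. 0 \<le> P t f x \<and> P t f x \<le> 1"

text \<open>\<open>f\<close> is in the domain of the infinitesimal generator, which sends it to \<open>h\<close>.\<close>

definition sg_generator ::
  "'a measure \<Rightarrow> (real \<Rightarrow> ('a \<Rightarrow> real) \<Rightarrow> 'a \<Rightarrow> real) \<Rightarrow> ('a \<Rightarrow> real) \<Rightarrow> ('a \<Rightarrow> real) \<Rightarrow> bool" where
  "sg_generator M P f h \<longleftrightarrow>
     f \<in> L2_space M \<and> h \<in> L2_space M \<and>
     ((\<lambda>t. L2_norm M (\<lambda>x. (P t f x - f x) / t - h x)) \<longlongrightarrow> 0) (at_right 0)"

text \<open>
  \<open>f\<close> is in the domain of the self-adjoint operator \<open>L\<close> of the form, determined by
  \<open>\<E> f g = - \<langle>L f, g\<rangle>\<close> for all \<open>g \<in> \<F>\<close>, and \<open>L f = h\<close>.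
\<close>

definition form_operator ::
  "'a measure \<Rightarrow> (('a \<Rightarrow> real) \<Rightarrow> ('a \<Rightarrow> real) \<Rightarrow> real) \<Rightarrow> ('a \<Rightarrow> real) set
     \<Rightarrow> ('a \<Rightarrow> real) \<Rightarrow> ('a \<Rightarrow> real) \<Rightarrow> bool" where
  "form_operator M \<E> \<F> f h \<longleftrightarrow>
     f \<in> \<F> \<and> h \<in> L2_space M \<and> (\<forall>g\<in>\<F>. \<E> f g = - L2_inner M h g)"

definition associated_semigroup ::
  "'a measure \<Rightarrow> (('a \<Rightarrow> real) \<Rightarrow> ('a \<Rightarrow> real) \<Rightarrow> real) \<Rightarrow> ('a \<Rightarrow> real) set
     \<Rightarrow> (real \<Rightarrow> ('a \<Rightarrow> real) \<Rightarrow> 'a \<Rightarrow> real) \<Rightarrow> bool" where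
  "associated_semigroup M \<E> \<F> P \<longleftrightarrow>
     markovian_semigroup M P \<and> (\<forall>f h. sg_generator M P f h \<longleftrightarrow> form_operator M \<E> \<F> f h)"

definition is_ess_sup :: "'a measure \<Rightarrow> ('a \<Rightarrow> real) set \<Rightarrow> ('a \<Rightarrow> real) \<Rightarrow> bool" where
  "is_ess_sup M S g \<longleftrightarrow>
     g \<in> borel_measurable M \<and>
     (\<forall>h\<in>S. AE x in M. h x \<le> g x) \<and>
     (\<forall>g'\<in>borel_measurable M. (\<forall>h\<in>S. AE x in M. h x \<le> g' x) \<longrightarrow> (AE x in M. g x \<le> g' x))"

text \<open>
  A bounded function such as \<open>1\<close> need not be in \<open>L\<^sup>2\<close>. For bounded \<open>f \<ge> 0\<close> the extension of the
  positive operator \<open>P t\<close> to \<open>L\<^sup>\<infinity>\<close> is the monotone one: \<open>P t f\<close> is the essential supremum of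
  \<open>P t h\<close> over \<open>h \<in> L\<^sup>2\<close> with \<open>0 \<le> h \<le> f\<close>. For a \<open>\<sigma>\<close>-finite measure this is the a.e. limit of
  \<open>P t (h n)\<close> along any sequence \<open>0 \<le> h n \<in> L\<^sup>2\<close> increasing to \<open>f\<close>.
\<close>

definition sg_extends ::
  "'a measure \<Rightarrow> (real \<Rightarrow> ('a \<Rightarrow> real) \<Rightarrow> 'a \<Rightarrow> real) \<Rightarrow> real \<Rightarrow> ('a \<Rightarrow> real) \<Rightarrow> ('a \<Rightarrow> real) \<Rightarrow> bool" where
  "sg_extends M P t f g \<longleftrightarrow>
     is_ess_sup M {P t h | h. h \<in> L2_space M \<and> (AE x in M. 0 \<le> h x \<and> h x \<le> f x)} g"

definition conservative :: "'a measure \<Rightarrow> (real \<Rightarrow> ('a \<Rightarrow> real) \<Rightarrow> 'a \<Rightarrow> real) \<Rightarrow> bool" where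
  "conservative M P \<longleftrightarrow> (\<forall>t>0. sg_extends M P t (\<lambda>x. 1) (\<lambda>x. 1))"

definition heat_kernel ::
  "'a measure \<Rightarrow> (real \<Rightarrow> ('a \<Rightarrow> real) \<Rightarrow> 'a \<Rightarrow> real) \<Rightarrow> (real \<Rightarrow> 'a \<Rightarrow> 'a \<Rightarrow> real) \<Rightarrow> bool" where
  "heat_kernel M P p \<longleftrightarrow>
     (\<forall>t>0.
        (\<lambda>(x, y). p t x y) \<in> borel_measurable (M \<Otimes>\<^sub>M M) \<and>
        (\<forall>x y. 0 \<le> p t x y) \<and>
        (\<forall>x y. p t x y = p t y x) \<and>
        (\<forall>f\<in>L2_space M. AE x in M.
           integrable M (\<lambda>y. p t x y * f y) \<and> P t f x = (\<integral>y. p t x y * f y \<partial>M)))"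

text \<open>
  Almost everywhere with respect to \<open>\<mu> \<times> \<mu>\<close>. The measure \<open>M \<Otimes>\<^sub>M M\<close> is the product measure only
  for \<open>\<sigma>\<close>-finite \<open>M\<close>, which is not assumed. In general, null sets are those that are null in every
  rectangle \<open>A \<times> B\<close> with sides of finite measure, as for the complete locally determined product;
  the lemma \<open>AE_product_sigma_finite\<close> shows that this is the usual notion in the \<open>\<sigma>\<close>-finite case.
\<close>

definition AE_product :: "'a measure \<Rightarrow> ('a \<Rightarrow> 'a \<Rightarrow> bool) \<Rightarrow> bool" where
  "AE_product M Q \<longleftrightarrow>
     (\<forall>A\<in>sets M. \<forall>B\<in>sets M. emeasure M A < \<infinity> \<longrightarrow> emeasure M B < \<infinity> \<longrightarrow>
        (AE (x, y) in restrict_space M A \<Otimes>\<^sub>M restrict_space M B. Q x y))"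

lemma restrict_space_pair_measure:
  assumes "sigma_finite_measure M" and A: "A \<in> sets M" and B: "B \<in> sets M"
  shows "restrict_space M A \<Otimes>\<^sub>M restrict_space M B = restrict_space (M \<Otimes>\<^sub>M M) (A \<times> B)"
proof -
  interpret sigma_finite_measure M by fact
  have sA: "sigma_finite_measure (restrict_space M A)"
    and sB: "sigma_finite_measure (restrict_space M B)"
    using A B by (auto intro: sigma_finite_measure_restrict_space[OF assms(1)])
  interpret B: sigma_finite_measure "restrict_space M B" by (rule sB)
  let ?L = "restrict_space M A \<Otimes>\<^sub>M restrict_space M B"
  let ?R = "restrict_space (M \<Otimes>\<^sub>M M) (A \<times> B)"
  have AB: "A \<times> B \<in> sets (M \<Otimes>\<^sub>M M)"
    using A B by auto
  have spL: "space ?L = A \<times> B"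
    using A B by (simp add: space_pair_measure space_restrict_space2)
  have fst_meas: "fst \<in> ?L \<rightarrow>\<^sub>M M"
    by (rule measurable_compose[OF measurable_fst measurable_restrict_space1]) simp
  have snd_meas: "snd \<in> ?L \<rightarrow>\<^sub>M M"
    by (rule measurable_compose[OF measurable_snd measurable_restrict_space1]) simp
  have id_meas: "(\<lambda>z. (fst z, snd z)) \<in> ?L \<rightarrow>\<^sub>M M \<Otimes>\<^sub>M M"
    by (rule measurable_Pair[OF fst_meas snd_meas])
  have sets_eq: "sets ?L = sets ?R"
  proof
    show "sets ?R \<subseteq> sets ?L"
    proof
      fix Y assume "Y \<in> sets ?R"
      then obtain X where X: "X \<in> sets (M \<Otimes>\<^sub>M M)" "Y = (A \<times> B) \<inter> X"
        by (auto simp: sets_restrict_space)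
      have "(\<lambda>z. (fst z, snd z)) -` X \<inter> space ?L \<in> sets ?L"
        using id_meas X(1) by (rule measurable_sets)
      then show "Y \<in> sets ?L"
        using X(2) spL by (simp add: Int_commute)
    qed
    have "a \<times> b \<in> sets ?R" if "a \<in> sets (restrict_space M A)" "b \<in> sets (restrict_space M B)" for a b
      using that A B AB by (auto simp: sets_restrict_space_iff)
    moreover have "space ?L = space ?R"
      using spL AB by (simp add: space_restrict_space2)
    ultimately show "sets ?L \<subseteq> sets ?R"
      unfolding sets_pair_measure
      by (intro sets.sigma_sets_subset') (auto simp: space_pair_measure)
  qed
  show ?thesis
  proof (rule pair_measure_eqI[OF sA sB sets_eq])
    fix a b assume ab: "a \<in> sets (restrict_space M A)" "b \<in> sets (restrict_space M B)"
    then have "a \<in> sets M" "a \<subseteq> A" "b \<in> sets M" "b \<subseteq> B"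
      using A B by (auto simp: sets_restrict_space_iff)
    then show "emeasure (restrict_space M A) a * emeasure (restrict_space M B) b = emeasure ?R (a \<times> b)"
      using A B AB by (subst (1 2 3) emeasure_restrict_space) (auto simp: emeasure_pair_measure_Times)
  qed
qed

lemma AE_product_sigma_finite:
  assumes "sigma_finite_measure M"
  shows "AE_product M Q \<longleftrightarrow> (AE (x, y) in M \<Otimes>\<^sub>M M. Q x y)"
proof -
  interpret sigma_finite_measure M by fact
  have eq: "(AE (x, y) in restrict_space M A \<Otimes>\<^sub>M restrict_space M B. Q x y)
      \<longleftrightarrow> (AE z in M \<Otimes>\<^sub>M M. z \<in> A \<times> B \<longrightarrow> (case z of (x, y) \<Rightarrow> Q x y))"
    if "A \<in> sets M" "B \<in> sets M" for A B
    unfolding restrict_space_pair_measure[OF assms that]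
    using that by (intro AE_restrict_space_iff sets.Int pair_measureI) auto
  show ?thesis
  proof
    assume Q: "AE_product M Q"
    obtain F :: "nat \<Rightarrow> 'a set" where F: "range F \<subseteq> sets M" "(\<Union>i. F i) = space M"
        "\<And>i. emeasure M (F i) \<noteq> \<infinity>"
      using sigma_finite by blast
    have "AE z in M \<Otimes>\<^sub>M M. \<forall>i j. z \<in> F i \<times> F j \<longrightarrow> (case z of (x, y) \<Rightarrow> Q x y)"
      unfolding AE_all_countable
    proof (intro allI)
      fix i j
      have "F i \<in> sets M" "F j \<in> sets M" "emeasure M (F i) < \<infinity>" "emeasure M (F j) < \<infinity>"
        using F(1) F(3)[of i] F(3)[of j] by (auto simp: top.not_eq_extremum)
      then show "AE z in M \<Otimes>\<^sub>M M. z \<in> F i \<times> F j \<longrightarrow> (case z of (x, y) \<Rightarrow> Q x y)"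
        using Q eq unfolding AE_product_def by blast
    qed
    then show "AE (x, y) in M \<Otimes>\<^sub>M M. Q x y"
    proof (rule AE_mp, intro AE_I2 impI)
      fix z assume z: "z \<in> space (M \<Otimes>\<^sub>M M)"
        and *: "\<forall>i j. z \<in> F i \<times> F j \<longrightarrow> (case z of (x, y) \<Rightarrow> Q x y)"
      from z have "fst z \<in> (\<Union>i. F i)" "snd z \<in> (\<Union>i. F i)"
        unfolding F(2) by (auto simp: space_pair_measure)
      then obtain i j where "z \<in> F i \<times> F j"
        by (auto simp: mem_Times_iff)
      with * show "case z of (x, y) \<Rightarrow> Q x y" by blast
    qed
  next
    assume "AE (x, y) in M \<Otimes>\<^sub>M M. Q x y"
    then show "AE_product M Q"
      unfolding AE_product_def using eq by auto
  qed
qed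

definition ennreal_powr :: "ennreal \<Rightarrow> real \<Rightarrow> ennreal" where
  "ennreal_powr a r = (if a = \<infinity> then \<infinity> else ennreal (enn2real a powr r))"

definition besov_seminorm ::
  "'a measure \<Rightarrow> (real \<Rightarrow> 'a \<Rightarrow> 'a \<Rightarrow> real) \<Rightarrow> real \<Rightarrow> real \<Rightarrow> ('a \<Rightarrow> real) \<Rightarrow> ennreal" where
  "besov_seminorm M p q \<alpha> f =
     (SUP t\<in>{0<..}. ennreal (t powr (-\<alpha>)) *
        ennreal_powr (\<integral>\<^sup>+ y. (\<integral>\<^sup>+ x. ennreal (\<bar>f x - f y\<bar> powr q * p t x y) \<partial>M) \<partial>M) (1 / q))"

definition besov_space ::
  "'a measure \<Rightarrow> (real \<Rightarrow> 'a \<Rightarrow> 'a \<Rightarrow> real) \<Rightarrow> real \<Rightarrow> real \<Rightarrow> ('a \<Rightarrow> real) set" where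
  "besov_space M p q \<alpha> = {f \<in> Lp_space M q. besov_seminorm M p q \<alpha> f < \<infinity>}"

end

theory Submission
  imports Defs
begin

text \<open>
  Since \<open>P\<^sub>t 1 = 1\<close>, the mass \<open>\<integral> p\<^sub>t(x, y) d\<mu>(x)\<close> is at least \<open>1\<close> for almost every \<open>y \<in> E\<close>, whereas the
  part of it carried by \<open>E\<close> is at most \<open>C t\<^sup>-\<^sup>\<beta> \<mu>(E)\<close>. For the time \<open>t\<close> with \<open>C t\<^sup>-\<^sup>\<beta> \<mu>(E) = 1/2\<close> at least
  half of the mass therefore lies outside \<open>E\<close>, so the double integral in \<open>\<parallel>1\<^sub>E\<parallel>\<close> is at least
  \<open>\<mu>(E)/2\<close>.

  No \<open>\<sigma>\<close>-finiteness is available, so \<open>y \<mapsto> \<integral> p\<^sub>t(x, y) d\<mu>(x)\<close> may fail to be measurable and the essential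
  supremum expressing \<open>P\<^sub>t 1 = 1\<close> ranges over an uncountable family. By symmetry of \<open>P\<^sub>t\<close>, only the
  part of the space where \<open>P\<^sub>t 1\<^sub>E > 0\<close> contributes to \<open>P\<^sub>t h\<close> on \<open>E\<close>, and this part is \<open>\<sigma>\<close>-finite because
  \<open>P\<^sub>t 1\<^sub>E \<in> L\<^sup>2\<close>.
\<close>

section \<open>Indicators and square-integrable functions\<close>

lemma indicator_in_Lp_space:
  assumes "A \<in> sets M" "emeasure M A < \<infinity>"
  shows "indicator A \<in> Lp_space M r"
proof -
  have "(\<lambda>x. \<bar>indicator A x :: real\<bar> powr r) = indicator A"
    by (auto simp: indicator_def)
  with assms show ?thesis
    by (simp add: Lp_space_def)
qed

text \<open>Membership of an indicator in \<open>besov_space\<close> is used in this form: once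
  finiteness is known, \<open>measure M A\<close> is the true measure of the set and not the default
  value 0 of a set of infinite measure.\<close>

lemma indicator_in_L1_imp_finite:
  assumes A: "A \<in> sets M" and L: "indicator A \<in> Lp_space M 1"
  shows "emeasure M A < \<infinity>"
proof -
  have "(\<lambda>x. \<bar>indicator A x :: real\<bar> powr 1) = indicator A"
    by (auto simp: indicator_def)
  with L have "integrable M (indicator A :: _ \<Rightarrow> real)"
    by (simp add: Lp_space_def)
  with A show ?thesis
    by (simp add: integrable_indicator_iff sets.Int_space_eq2)
qed

lemma Lp_space_mult_indicator:
  assumes f: "f \<in> Lp_space M r" and A: "A \<in> sets M"
  shows "(\<lambda>x. f x * indicator A x) \<in> Lp_space M r"
proof -
  have "(\<lambda>x. \<bar>f x * indicator A x\<bar> powr r) = (\<lambda>x. \<bar>f x\<bar> powr r * indicator A x)"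
    by (auto simp: indicator_def)
  moreover have "integrable M (\<lambda>x. \<bar>f x\<bar> powr r * indicator A x)"
    using f A by (intro integrable_real_mult_indicator) (auto simp: Lp_space_def)
  ultimately show ?thesis
    using f A by (auto simp: Lp_space_def)
qed

lemma L2_space_integrable_mult:
  assumes "f \<in> L2_space M" "g \<in> L2_space M"
  shows "integrable M (\<lambda>x. f x * g x)"
proof (rule Bochner_Integration.integrable_bound)
  show "integrable M (\<lambda>x. \<bar>f x\<bar> powr 2 + \<bar>g x\<bar> powr 2)"
    using assms by (auto simp: Lp_space_def)
  show "(\<lambda>x. f x * g x) \<in> borel_measurable M"
    using assms by (auto simp: Lp_space_def)
  have "\<bar>a * b\<bar> \<le> a\<^sup>2 + b\<^sup>2" for a b :: real
  proof -
    have "0 \<le> \<bar>a\<bar> * \<bar>b\<bar>" by simp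
    with sum_squares_bound[of "\<bar>a\<bar>" "\<bar>b\<bar>"] show ?thesis
      unfolding abs_mult power2_abs by linarith
  qed
  then show "AE x in M. norm (f x * g x) \<le> norm (\<bar>f x\<bar> powr 2 + \<bar>g x\<bar> powr 2)"
    by (simp add: powr_numeral)
qed

text \<open>Chebyshev: the indicator is at most f^2 / c^2. Letting c run through 1/(n+1) makes the
  positivity set of an L2 function a countable union of sets of finite measure.\<close>

lemma L2_space_superlevel_finite:
  assumes f: "f \<in> L2_space M" and c: "0 < c"
  shows "emeasure M {x\<in>space M. c \<le> f x} < \<infinity>"
proof -
  have meas: "f \<in> borel_measurable M" and int: "integrable M (\<lambda>x. \<bar>f x\<bar> powr 2)"
    using f by (auto simp: Lp_space_def)
  have "integrable M (indicator {x\<in>space M. c \<le> f x} :: _ \<Rightarrow> real)"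
  proof (rule Bochner_Integration.integrable_bound)
    show "integrable M (\<lambda>x. \<bar>f x\<bar> powr 2 / c\<^sup>2)"
      using int by simp
    show "indicator {x\<in>space M. c \<le> f x} \<in> borel_measurable M"
      using meas by measurable
    have "c\<^sup>2 \<le> (f x)\<^sup>2" if "c \<le> f x" for x
      using that c by (simp add: power_mono)
    then show "AE x in M. norm (indicator {x\<in>space M. c \<le> f x} x :: real) \<le> norm (\<bar>f x\<bar> powr 2 / c\<^sup>2)"
      using c by (intro AE_I2) (auto simp: indicator_def powr_numeral)
  qed
  then show ?thesis
    using meas by (simp add: integrable_indicator_iff sets.Int_space_eq2)
qed

lemma ennreal_powr_1: "ennreal_powr a 1 = a"
  by (auto simp: ennreal_powr_def top.not_eq_extremum)

lemma ennreal_integral_le_nn_integral: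
  assumes "integrable M f" "AE x in M. 0 \<le> f x"
  shows "ennreal (\<integral>x. f x \<partial>M) \<le> (\<integral>\<^sup>+x. ennreal (f x) \<partial>M)"
  using nn_integral_eq_integral[OF assms] by simp

section \<open>The mass of the heat kernel\<close>

locale conservative_heat_semigroup = markovian_semigroup M P
  for M :: "'a measure" and P +
  fixes p :: "real \<Rightarrow> 'a \<Rightarrow> 'a \<Rightarrow> real"
  assumes conservative: "conservative M P"
    and heat_kernel: "heat_kernel M P p"
begin

lemma kernel_nonneg: "0 < t \<Longrightarrow> 0 \<le> p t x y"
  and kernel_sym: "0 < t \<Longrightarrow> p t x y = p t y x"
  and kernel_AE: "0 < t \<Longrightarrow> f \<in> L2_space M \<Longrightarrow>
     AE x in M. integrable M (\<lambda>y. p t x y * f y) \<and> P t f x = (\<integral>y. p t x y * f y \<partial>M)"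
  using heat_kernel unfolding heat_kernel_def by blast+

lemma kernel_measurable:
  assumes "0 < t" "x \<in> space M"
  shows "(\<lambda>y. p t x y) \<in> borel_measurable M"
proof -
  have "(\<lambda>(x, y). p t x y) \<in> borel_measurable (M \<Otimes>\<^sub>M M)"
    using heat_kernel assms(1) unfolding heat_kernel_def by blast
  from measurable_compose[OF measurable_Pair1'[OF assms(2)] this] show ?thesis
    by simp
qed

text \<open>Passing to a nonnegative integral gives access to monotone convergence. The exceptional
  null set depends on \<open>f\<close>, so the formula is applied below to a countable
  family.\<close>

lemma semigroup_AE_nn_integral:
  assumes t: "0 < t" and f: "f \<in> L2_space M" and f0: "\<And>x. 0 \<le> f x"
  shows "AE y in M. ennreal (P t f y) = (\<integral>\<^sup>+x. ennreal (p t y x * f x) \<partial>M)"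
  using kernel_AE[OF t f]
  by eventually_elim (simp add: nn_integral_eq_integral kernel_nonneg[OF t] f0)

text \<open>\<open>\<langle>1\<^sub>E, P\<^sub>t h\<rangle> = \<langle>P\<^sub>t 1\<^sub>E, h\<rangle> = 0\<close>.\<close>

lemma semigroup_AE_zero_on:
  assumes t: "0 < t" and E: "E \<in> sets M" "emeasure M E < \<infinity>"
    and h: "h \<in> L2_space M" "AE x in M. 0 \<le> h x \<and> h x \<le> 1"
    and disj: "AE x in M. P t (indicator E) x * h x = 0"
  shows "AE y in M. y \<in> E \<longrightarrow> P t h y = 0"
proof -
  have t0: "0 \<le> t" using t by simp
  have EL: "indicator E \<in> L2_space M"
    using E by (rule indicator_in_Lp_space)
  have "(\<integral>x. indicator E x * P t h x \<partial>M) = (\<integral>x. P t (indicator E) x * h x \<partial>M)"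
    using sg_symmetric[OF t0 EL h(1)] by (simp add: L2_inner_def)
  also have "\<dots> = 0"
    using disj by (rule integral_eq_zero_AE)
  finally have 0: "(\<integral>x. indicator E x * P t h x \<partial>M) = 0" .
  \<comment> \<open>Positivity of \<open>P t h\<close> turns the vanishing integral over
    \<open>E\<close> into vanishing a.e. on \<open>E\<close>.\<close>
  have "AE x in M. 0 \<le> indicator E x * P t h x"
    using sg_markovian[OF t0 h] by eventually_elim simp
  moreover have "integrable M (\<lambda>x. indicator E x * P t h x)"
    using EL sg_L2[OF t0 h(1)] by (rule L2_space_integrable_mult)
  ultimately have "AE x in M. indicator E x * P t h x = 0"
    using 0 by (simp add: integral_nonneg_eq_0_iff_AE)
  then show ?thesis
    by eventually_elim (auto simp: indicator_def)
qed

text \<open>The constant 1 is the least measurable a.e. upper bound of all \<open>P t h\<close> with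
  0 \<le> h \<le> 1. It therefore suffices to construct a measurable upper bound \<open>g\<close>
  that on \<open>E\<close> is a.e. at most the kernel mass.\<close>

lemma kernel_mass_ge_1:
  assumes t: "0 < t" and E: "E \<in> sets M" "emeasure M E < \<infinity>"
  shows "AE y in M. y \<in> E \<longrightarrow> 1 \<le> (\<integral>\<^sup>+x. ennreal (p t y x) \<partial>M)"
proof -
  have t0: "0 \<le> t" using t by simp
  have EL: "indicator E \<in> L2_space M"
    using E by (rule indicator_in_Lp_space)
  define u where "u = P t (indicator E)"
  have u: "u \<in> L2_space M"
    unfolding u_def using t0 EL by (rule sg_L2)
  have u_meas [measurable]: "u \<in> borel_measurable M"
    using u by (auto simp: Lp_space_def)
  have u_nonneg: "AE x in M. 0 \<le> u x"
    using sg_markovian[OF t0 EL] by (simp add: u_def)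
  \<comment> \<open>Only the part of \<open>h\<close> on \<open>S\<close> contributes to
    \<open>P t h\<close> on \<open>E\<close>. The sets \<open>R n\<close> exhaust \<open>S\<close>
    and have finite measure, so the kernel formula applies to their indicators.\<close>
  define S where "S = {x\<in>space M. 0 < u x}"
  define R where "R n = {x\<in>space M. inverse (real (Suc n)) \<le> u x}" for n
  have S: "S \<in> sets M" and R: "\<And>n. R n \<in> sets M"
    unfolding S_def R_def by measurable
  have RL: "indicator (R n) \<in> L2_space M" for n
    using R L2_space_superlevel_finite[OF u] unfolding R_def
    by (intro indicator_in_Lp_space) auto
  have incR: "incseq R"
  proof (rule incseq_SucI)
    fix n
    have "inverse (real (Suc (Suc n))) \<le> inverse (real (Suc n))"
      by (rule le_imp_inverse_le) auto
    then show "R n \<subseteq> R (Suc n)"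
      unfolding R_def by (blast intro: order_trans)
  qed
  have SR: "S = (\<Union>n. R n)"
  proof
    show "S \<subseteq> (\<Union>n. R n)"
      unfolding S_def R_def using reals_Archimedean by (fastforce intro: less_imp_le)
    show "(\<Union>n. R n) \<subseteq> S"
      unfolding S_def R_def
      by (auto intro: less_le_trans[of 0 "inverse (real (Suc _))"])
  qed
  \<comment> \<open>A countable supremum, hence measurable; by monotone convergence it agrees a.e.
    with the kernel mass over \<open>S\<close>.\<close>
  define G where "G y = (SUP n. ennreal (P t (indicator (R n)) y))" for y
  have G_meas [measurable]: "G \<in> borel_measurable M"
  proof -
    have "P t (indicator (R n)) \<in> borel_measurable M" for n
      using sg_L2[OF t0 RL[of n]] by (simp add: Lp_space_def)
    then show ?thesis unfolding G_def by measurable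
  qed
  have G_eq: "AE y in M. G y = (\<integral>\<^sup>+x. ennreal (p t y x) * indicator S x \<partial>M)"
  proof -
    have "AE y in M. \<forall>n. ennreal (P t (indicator (R n)) y) = (\<integral>\<^sup>+x. ennreal (p t y x * indicator (R n) x) \<partial>M)"
      unfolding AE_all_countable using semigroup_AE_nn_integral[OF t RL] by simp
    then show ?thesis
      using AE_space
    proof eventually_elim
      fix y assume y: "y \<in> space M"
        and *: "\<forall>n. ennreal (P t (indicator (R n)) y) = (\<integral>\<^sup>+x. ennreal (p t y x * indicator (R n) x) \<partial>M)"
      note [measurable] = kernel_measurable[OF t y] R
      have "G y = (SUP n. \<integral>\<^sup>+x. ennreal (p t y x) * indicator (R n) x \<partial>M)"
        unfolding G_def using *
        by (simp add: ennreal_mult'' ennreal_indicator)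
      also have "\<dots> = (\<integral>\<^sup>+x. (SUP n. ennreal (p t y x) * indicator (R n) x) \<partial>M)"
      proof (rule nn_integral_monotone_convergence_SUP[symmetric])
        show "incseq (\<lambda>n x. ennreal (p t y x) * indicator (R n) x)"
          using incR by (auto simp: incseq_def le_fun_def indicator_def)
        show "(\<lambda>x. ennreal (p t y x) * indicator (R n) x) \<in> borel_measurable M" for n
          by measurable
      qed
      also have "\<dots> = (\<integral>\<^sup>+x. ennreal (p t y x) * indicator S x \<partial>M)"
      proof (rule nn_integral_cong)
        fix x
        have "(SUP n. ennreal (p t y x) * indicator (R n) x) = ennreal (p t y x) * (SUP n. indicator (R n) x)"
          by (simp add: SUP_mult_left_ennreal)
        also have "(SUP n. indicator (R n) x :: ennreal) = indicator S x"
          unfolding SR by (auto simp: indicator_def intro!: antisym SUP_least intro: SUP_upper2)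
        finally show "(SUP n. ennreal (p t y x) * indicator (R n) x) = ennreal (p t y x) * indicator S x" .
      qed
      finally show "G y = (\<integral>\<^sup>+x. ennreal (p t y x) * indicator S x \<partial>M)" .
    qed
  qed
  \<comment> \<open>The cut at 1 excludes the value infinity, which \<open>enn2real\<close> would
    send to 0. Off \<open>E\<close>, 1 is an upper bound by the Markov property.\<close>
  define g where "g y = (if y \<in> E then enn2real (min 1 (G y)) else 1)" for y
  have g_meas: "g \<in> borel_measurable M"
    unfolding g_def using E(1) by measurable
  have upper: "AE y in M. P t h y \<le> g y"
    if h: "h \<in> L2_space M" and h01: "AE x in M. 0 \<le> h x \<and> h x \<le> 1" for h
  proof -
    \<comment> \<open>Since \<open>u\<close> vanishes a.e. off \<open>S\<close>,
      \<open>P t h2\<close> is zero a.e. on \<open>E\<close>. There only \<open>P t h1\<close>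
      remains, and a.e. \<open>h1\<close> is at most the indicator of \<open>S\<close>, which gives
      the bound \<open>G\<close>.\<close>
    define h1 where "h1 = (\<lambda>x. h x * indicator S x)"
    define h2 where "h2 = (\<lambda>x. h x * indicator (space M - S) x)"
    have h1: "h1 \<in> L2_space M" and h2: "h2 \<in> L2_space M"
      unfolding h1_def h2_def using h S by (auto intro: Lp_space_mult_indicator)
    have eq: "AE_eq M h (\<lambda>x. h1 x + h2 x)"
      unfolding AE_eq_def h1_def h2_def by (intro AE_I2) (auto simp: indicator_def)
    have sum: "(\<lambda>x. h1 x + h2 x) \<in> L2_space M"
    proof -
      have "integrable M (\<lambda>x. \<bar>h1 x + h2 x\<bar> powr 2) \<longleftrightarrow> integrable M (\<lambda>x. \<bar>h x\<bar> powr 2)"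
        unfolding h1_def h2_def
        by (intro Bochner_Integration.integrable_cong) (auto simp: indicator_def)
      then show ?thesis
        using h h1 h2 by (auto simp: Lp_space_def)
    qed
    have add: "AE y in M. P t h y = P t h1 y + P t h2 y"
      using sg_AE[OF t0 h sum eq] sg_add[OF t0 h1 h2] unfolding AE_eq_def
      by eventually_elim simp
    have "AE x in M. 0 \<le> h2 x \<and> h2 x \<le> 1"
      using h01 by eventually_elim (auto simp: h2_def indicator_def)
    moreover have "AE x in M. P t (indicator E) x * h2 x = 0"
      using u_nonneg by (rule AE_mp) (intro AE_I2, auto simp: u_def h2_def S_def indicator_def)
    ultimately have zero: "AE y in M. y \<in> E \<longrightarrow> P t h2 y = 0"
      using h2 by (intro semigroup_AE_zero_on[OF t E])
    from add zero G_eq kernel_AE[OF t h1] sg_markovian[OF t0 h h01]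
    show ?thesis
    proof eventually_elim
      case (elim y)
      show ?case
      proof (cases "y \<in> E")
        case True
        have "ennreal (P t h y) = ennreal (\<integral>x. p t y x * h1 x \<partial>M)"
          using elim True by simp
        also have "\<dots> \<le> (\<integral>\<^sup>+x. ennreal (p t y x * h1 x) \<partial>M)"
        proof (rule ennreal_integral_le_nn_integral)
          show "AE x in M. 0 \<le> p t y x * h1 x"
            using h01 by eventually_elim (simp add: h1_def kernel_nonneg[OF t])
        qed (use elim in simp)
        also have "\<dots> \<le> (\<integral>\<^sup>+x. ennreal (p t y x) * indicator S x \<partial>M)"
        proof (rule nn_integral_mono_AE)
          show "AE x in M. ennreal (p t y x * h1 x) \<le> ennreal (p t y x) * indicator S x"
            using h01
            by eventually_elim
              (auto simp: h1_def indicator_def kernel_nonneg[OF t] mult_left_le intro: ennreal_leI)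
        qed
        also have "\<dots> = G y"
          using elim by simp
        finally have "ennreal (P t h y) \<le> min 1 (G y)"
          using elim by simp
        then have "enn2real (ennreal (P t h y)) \<le> enn2real (min 1 (G y))"
          by (rule enn2real_mono) (simp add: min_less_iff_disj)
        with elim True show ?thesis
          by (simp add: g_def)
      next
        case False
        with elim show ?thesis by (simp add: g_def)
      qed
    qed
  qed
  have "is_ess_sup M {P t h | h. h \<in> L2_space M \<and> (AE x in M. 0 \<le> h x \<and> h x \<le> 1)} (\<lambda>x. 1)"
    using conservative t unfolding conservative_def sg_extends_def by blast
  then have "AE y in M. 1 \<le> g y"
    using g_meas upper unfolding is_ess_sup_def by blast
  then show ?thesis
    using G_eq
  proof eventually_elim
    case (elim y)
    show ?case
    proof
      assume y: "y \<in> E"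
      have "1 \<le> enn2real (min 1 (G y))"
        using elim y by (simp add: g_def)
      then have "ennreal 1 \<le> ennreal (enn2real (min 1 (G y)))"
        by (rule ennreal_leI)
      also have "\<dots> = min 1 (G y)"
        by (rule ennreal_enn2real) (simp add: min_less_iff_disj)
      also have "\<dots> \<le> G y" by simp
      also have "\<dots> = (\<integral>\<^sup>+x. ennreal (p t y x) * indicator S x \<partial>M)"
        using elim by simp
      also have "\<dots> \<le> (\<integral>\<^sup>+x. ennreal (p t y x) \<partial>M)"
        by (rule nn_integral_mono) (auto simp: indicator_def)
      finally show "1 \<le> (\<integral>\<^sup>+x. ennreal (p t y x) \<partial>M)" by simp
    qed
  qed
qed

section \<open>The kernel bound and the choice of time\<close>

lemma kernel_mass_on_le:
  assumes E: "E \<in> sets M" "emeasure M E < \<infinity>" and K: "0 \<le> K"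
    and bound: "AE_product M (\<lambda>x y. p t x y \<le> K)"
  shows "AE y in M. y \<in> E \<longrightarrow> (\<integral>\<^sup>+x. ennreal (p t y x) * indicator E x \<partial>M) \<le> ennreal K * emeasure M E"
proof -
  let ?R = "restrict_space M E"
  \<comment> \<open>On the rectangle E x E, \<open>AE_product\<close> refers to a product of finite
    measures, so the bound passes to almost every section.\<close>
  interpret R: finite_measure ?R
    using E by (intro finite_measureI) (simp add: emeasure_restrict_space space_restrict_space2 top.not_eq_extremum)
  interpret RR: pair_sigma_finite ?R ?R ..
  have "AE (x, y) in ?R \<Otimes>\<^sub>M ?R. p t x y \<le> K"
    using bound E unfolding AE_product_def by blast
  then have "AE y in ?R. AE x in ?R. p t y x \<le> K"
    by (auto dest: RR.AE_pair)
  then have "AE y in M. y \<in> E \<longrightarrow> (AE x in M. x \<in> E \<longrightarrow> p t y x \<le> K)"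
    using E by (simp add: AE_restrict_space_iff)
  then show ?thesis
  proof (eventually_elim, intro impI)
    fix y assume "y \<in> E \<longrightarrow> (AE x in M. x \<in> E \<longrightarrow> p t y x \<le> K)" "y \<in> E"
    then have "AE x in M. ennreal (p t y x) * indicator E x \<le> ennreal K * indicator E x"
      by (auto simp: indicator_def ennreal_leI elim!: eventually_mono)
    then have "(\<integral>\<^sup>+x. ennreal (p t y x) * indicator E x \<partial>M) \<le> (\<integral>\<^sup>+x. ennreal K * indicator E x \<partial>M)"
      by (rule nn_integral_mono_AE)
    also have "\<dots> = ennreal K * emeasure M E"
      using E by (simp add: nn_integral_cmult_indicator)
    finally show "(\<integral>\<^sup>+x. ennreal (p t y x) * indicator E x \<partial>M) \<le> ennreal K * emeasure M E" .
  qed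
qed

text \<open>Only \<open>y\<close> in \<open>E\<close> is kept in the outer integral. For such
  \<open>y\<close> the inner integral is the kernel mass outside \<open>E\<close>: a total of at
  least 1, less at most 1/2 on \<open>E\<close>.\<close>

lemma indicator_energy_lower_bound:
  assumes t: "0 < t" and E: "E \<in> sets M" "emeasure M E < \<infinity>" and K: "0 \<le> K"
    and bound: "AE_product M (\<lambda>x y. p t x y \<le> K)"
    and half: "K * measure M E \<le> 1 / 2"
  shows "ennreal (measure M E / 2) \<le>
    (\<integral>\<^sup>+y. (\<integral>\<^sup>+x. ennreal (\<bar>indicator E x - indicator E y\<bar> powr 1 * p t x y) \<partial>M) \<partial>M)"
proof -
  let ?I = "\<lambda>y. \<integral>\<^sup>+x. ennreal (\<bar>indicator E x - indicator E y\<bar> powr 1 * p t x y) \<partial>M"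
  have em: "emeasure M E = ennreal (measure M E)"
    using E by (simp add: emeasure_eq_ennreal_measure)
  have Kmu: "ennreal K * emeasure M E \<le> ennreal (1 / 2)"
    using half K by (simp add: em ennreal_mult[symmetric] ennreal_leI del: ennreal_half)
  have "AE y in M. ennreal (1 / 2) * indicator E y \<le> ?I y"
    using kernel_mass_ge_1[OF t E] kernel_mass_on_le[OF E K bound] AE_space
  proof eventually_elim
    case (elim y)
    show ?case
    proof (cases "y \<in> E")
      case True
      note [measurable] = kernel_measurable[OF t elim(3)] E(1)
      have "?I y = (\<integral>\<^sup>+x. ennreal (p t y x) * indicator (space M - E) x \<partial>M)"
        using True kernel_sym[OF t] by (intro nn_integral_cong) (auto simp: indicator_def)
      moreover have "(\<integral>\<^sup>+x. ennreal (p t y x) \<partial>M) =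
          (\<integral>\<^sup>+x. ennreal (p t y x) * indicator E x + ennreal (p t y x) * indicator (space M - E) x \<partial>M)"
        by (intro nn_integral_cong) (auto simp: indicator_def)
      ultimately have "1 \<le> (\<integral>\<^sup>+x. ennreal (p t y x) * indicator E x \<partial>M) + ?I y"
        using elim True by (simp add: nn_integral_add)
      also have "\<dots> \<le> ennreal (1 / 2) + ?I y"
        using elim True Kmu by (intro add_right_mono) (auto intro: order_trans)
      finally have le: "ennreal 1 \<le> ennreal (1 / 2) + ?I y"
        by simp
      have "ennreal (1 / 2) \<le> ?I y"
      proof (cases "?I y")
        case (real r)
        then have "1 \<le> 1 / 2 + r"
          using le by (simp add: ennreal_plus[symmetric] del: ennreal_plus ennreal_half ennreal_1)
        with real show ?thesis
          by (simp add: ennreal_leI del: ennreal_half)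
      qed simp
      with True show ?thesis by simp
    qed simp
  qed
  \<comment> \<open>\<open>nn_integral\<close> is monotone for arbitrary integrands, so
    measurability of \<open>?I\<close> is not at issue.\<close>
  then have "(\<integral>\<^sup>+y. ennreal (1 / 2) * indicator E y \<partial>M) \<le> (\<integral>\<^sup>+y. ?I y \<partial>M)"
    by (rule nn_integral_mono_AE)
  moreover have "(\<integral>\<^sup>+y. ennreal (1 / 2) * indicator E y \<partial>M) = ennreal (measure M E / 2)"
    using E by (simp add: nn_integral_cmult_indicator em ennreal_mult[symmetric] del: ennreal_half)
  ultimately show ?thesis by simp
qed

lemma isoperimetric_inequality:
  assumes C: "0 < C" and \<alpha>: "0 < \<alpha>" and \<beta>: "\<alpha> < \<beta>"
    and bound: "\<And>t. t > 0 \<Longrightarrow> AE_product M (\<lambda>x y. p t x y \<le> C * t powr (-\<beta>))"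
    and E: "E \<in> sets M" "emeasure M E < \<infinity>"
  shows "ennreal (measure M E powr ((\<beta> - \<alpha>) / \<beta>))
    \<le> ennreal (2 * (2 * C) powr (\<alpha> / \<beta>)) * besov_seminorm M p 1 \<alpha> (indicator E)"
\<comment> \<open>Measure 0 makes the left side 0, while the time chosen below would be 0 and hence
  inadmissible.\<close>
proof (cases "measure M E = 0")
  case False
  define m where "m = measure M E"
  have m: "0 < m" using False by (simp add: m_def zero_less_measure_iff)
  \<comment> \<open>The solution of C t^(-\<beta>) m = 1/2.\<close>
  define t where "t = (2 * C * m) powr (1 / \<beta>)"
  have t: "0 < t" using C m by (simp add: t_def)
  have "t powr (-\<beta>) = inverse (2 * C * m)"
    using C m \<alpha> \<beta> by (simp add: t_def powr_powr powr_minus)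
  then have half: "C * t powr (-\<beta>) * m \<le> 1 / 2"
    using C m by (simp add: field_simps)
  have t\<alpha>: "t powr (-\<alpha>) = (2 * C) powr (-(\<alpha> / \<beta>)) * m powr (-(\<alpha> / \<beta>))"
    using C m by (simp add: t_def powr_powr powr_mult)
  have "m powr ((\<beta> - \<alpha>) / \<beta>) = m powr (1 + -(\<alpha> / \<beta>))"
    using \<alpha> \<beta> by (simp add: field_simps)
  also have "\<dots> = m * m powr (-(\<alpha> / \<beta>))"
    using m by (simp only: powr_add powr_one)
  \<comment> \<open>The constant arises here: 2 compensates the half in m/2, and
    (2C)^(\<alpha>/\<beta>) cancels the C-dependent factor of t^(-\<alpha>).\<close>
  also have "\<dots> = 2 * (2 * C) powr (\<alpha> / \<beta>) * (t powr (-\<alpha>) * (m / 2))"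
    unfolding t\<alpha> using C by (simp add: powr_minus field_simps)
  finally have "ennreal (m powr ((\<beta> - \<alpha>) / \<beta>)) =
      ennreal (2 * (2 * C) powr (\<alpha> / \<beta>)) * (ennreal (t powr (-\<alpha>)) * ennreal (m / 2))"
    using m by (simp add: ennreal_mult[symmetric])
  also have "ennreal (t powr (-\<alpha>)) * ennreal (m / 2) \<le> besov_seminorm M p 1 \<alpha> (indicator E)"
  proof -
    have "ennreal (m / 2) \<le> (\<integral>\<^sup>+y. (\<integral>\<^sup>+x. ennreal (\<bar>indicator E x - indicator E y\<bar> powr 1 * p t x y) \<partial>M) \<partial>M)"
      unfolding m_def
      using indicator_energy_lower_bound[OF t E _ bound[OF t]] half C by (simp add: m_def)
    then show ?thesis
      unfolding besov_seminorm_def div_by_1 ennreal_powr_1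
      using t by (intro SUP_upper2[of t] mult_left_mono) auto
  qed
  finally show ?thesis
    by (simp add: m_def mult_left_mono)
qed simp

end

theorem theorem0p6:
  fixes M :: "'a::topological_space measure"
    and \<E> :: "('a \<Rightarrow> real) \<Rightarrow> ('a \<Rightarrow> real) \<Rightarrow> real"
    and \<F> :: "('a \<Rightarrow> real) set"
    and P :: "real \<Rightarrow> ('a \<Rightarrow> real) \<Rightarrow> 'a \<Rightarrow> real"
    and p :: "real \<Rightarrow> 'a \<Rightarrow> 'a \<Rightarrow> real"
    and C \<alpha> \<beta> :: real
  assumes "radon_measure M"
    and "dirichlet_form M \<E> \<F>"
    and "associated_semigroup M \<E> \<F> P"
    and "conservative M P"
    and "heat_kernel M P p"
    and "C > 0" and "\<beta> > 0"
    and "\<And>t. t > 0 \<Longrightarrow> AE_product M (\<lambda>x y. p t x y \<le> C * t powr (-\<beta>))"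
    and "0 < \<alpha>" and "\<alpha> < \<beta>"
  shows "\<exists>C_iso>0. \<forall>E\<in>sets M. indicator E \<in> besov_space M p 1 \<alpha> \<longrightarrow>
           ennreal (measure M E powr ((\<beta> - \<alpha>) / \<beta>))
             \<le> ennreal C_iso * besov_seminorm M p 1 \<alpha> (indicator E)"
proof -
  interpret conservative_heat_semigroup M P p
    using assms(3-5)
    by (simp add: conservative_heat_semigroup_def conservative_heat_semigroup_axioms_def
        associated_semigroup_def)
  have "ennreal (measure M E powr ((\<beta> - \<alpha>) / \<beta>))
      \<le> ennreal (2 * (2 * C) powr (\<alpha> / \<beta>)) * besov_seminorm M p 1 \<alpha> (indicator E)"
    if "E \<in> sets M" "indicator E \<in> besov_space M p 1 \<alpha>" for E
    using assms(6,8-10) that indicator_in_L1_imp_finite[OF that(1)]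
    by (intro isoperimetric_inequality) (auto simp: besov_space_def)
  moreover have "0 < 2 * (2 * C) powr (\<alpha> / \<beta>)"
    using \<open>C > 0\<close> by simp
  ultimately show ?thesis by blast
qed

end
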